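(* There is a constant $c$ such that for all integers $d\ge 3$, $$f_{\mathrm{sph}}(n,d) = \Omega\left(n^{\frac{\min\{d,4\}}{d+1}-\frac{c}{\log\log n}}\right)$$ as $n\to\infty$.
   Context: $[n]=\{1,\dots,n\}$. $f_{\mathrm{sph}}(n,d)$ is the maximum size of a subset of $[n]^d$ containing no $d+2$ distinct points lying on a common $(d-1)$-dimensional sphere in $\mathbb{R}^d$, where a hyperplane is also considered a (degenerate) sphere. The implied constant may depend on $d$. *)

theory Defs
  imports Complex_Main "HOL-Library.FuncSet" "HOL-Library.Landau_Symbols"
begin

text \<open>
  The dimension \<open>d\<close> is quantified inside the statement, so it cannot be a type.  Points of
  \<open>d\<close>-dimensional real space are extensional functions on the index set \<open>{..<d}\<close>; with this
  choice equality of points is equality of their \<open>d\<close> coordinates, so cardinalities of sets of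
  points are the intended ones.
\<close>

definition real_space :: "nat \<Rightarrow> (nat \<Rightarrow> real) set" where
  "real_space d = {..<d} \<rightarrow>\<^sub>E UNIV"

definition grid :: "nat \<Rightarrow> nat \<Rightarrow> (nat \<Rightarrow> real) set" where
  "grid n d = {..<d} \<rightarrow>\<^sub>E real ` {1..n}"

definition is_round_sphere :: "nat \<Rightarrow> (nat \<Rightarrow> real) set \<Rightarrow> bool" where
  "is_round_sphere d S \<longleftrightarrow>
     (\<exists>z \<in> real_space d. \<exists>r > 0. S = {x \<in> real_space d. (\<Sum>i<d. (x i - z i)\<^sup>2) = r\<^sup>2})"

definition is_hyperplane :: "nat \<Rightarrow> (nat \<Rightarrow> real) set \<Rightarrow> bool" where
  "is_hyperplane d S \<longleftrightarrow>
     (\<exists>a \<in> real_space d. \<exists>b. (\<exists>i<d. a i \<noteq> 0) \<and> S = {x \<in> real_space d. (\<Sum>i<d. a i * x i) = b})"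

text \<open>Hyperplanes count as degenerate spheres.\<close>

definition is_sphere :: "nat \<Rightarrow> (nat \<Rightarrow> real) set \<Rightarrow> bool" where
  "is_sphere d S \<longleftrightarrow> is_round_sphere d S \<or> is_hyperplane d S"

definition no_cospherical :: "nat \<Rightarrow> (nat \<Rightarrow> real) set \<Rightarrow> bool" where
  "no_cospherical d A \<longleftrightarrow> \<not> (\<exists>S T. is_sphere d S \<and> T \<subseteq> A \<and> T \<subseteq> S \<and> card T = d + 2)"

definition f_sph :: "nat \<Rightarrow> nat \<Rightarrow> nat" where
  "f_sph n d = Max {card A | A. A \<subseteq> grid n d \<and> no_cospherical d A}"

text \<open>The maximum is taken over a finite nonempty set, so it is attained.\<close>

lemma f_sph_set_finite: "finite {card A | A. A \<subseteq> grid n d \<and> no_cospherical d A}"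
proof -
  have "finite (grid n d)"
    unfolding grid_def by (intro finite_PiE) auto
  then have "finite (card ` Pow (grid n d))"
    by blast
  then show ?thesis
    by (rule rev_finite_subset) blast
qed

lemma f_sph_set_nonempty: "{card A | A. A \<subseteq> grid n d \<and> no_cospherical d A} \<noteq> {}"
proof -
  have "no_cospherical d {}"
    by (auto simp: no_cospherical_def)
  then show ?thesis
    by blast
qed

end

theory Submission
  imports Defs "HOL-Number_Theory.Number_Theory" "HOL-Real_Asymp.Real_Asymp"
    "Jordan_Normal_Form.Determinant"
begin

text \<open>
  Let \<open>p\<close> be a prime with \<open>p mod 4 = 1\<close> and let \<open>I\<^sup>2 = -1\<close> modulo \<open>p\<close>.  On the curve over the
  field with \<open>p\<close> elements with coordinates \<open>x i = t ^ (i + 1) + I * t ^ (d - i)\<close> for \<open>i < d\<close>, the sum of the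
  squares of the coordinates is \<open>2 * d * I * t ^ (d + 1)\<close>.  Hence the functions \<open>1\<close>, \<open>x i\<close> and
  \<open>\<Sum>i. (x i)\<^sup>2\<close> form a basis of the polynomials in \<open>t\<close> of degree at most \<open>d + 1\<close>, and a sphere or
  hyperplane modulo \<open>p\<close> meets the curve in at most \<open>d + 1\<close> points.  A real sphere through \<open>d + 2\<close>
  lattice points makes an integer determinant vanish and so also gives a sphere or hyperplane modulo
  \<open>p\<close>.  Reducing the curve into \<open>{1..p}\<close> therefore yields \<open>p\<close> points of the grid.

  A prime \<open>p\<close> of this kind exists between \<open>n powr (4/5)\<close> and \<open>n\<close> by an elementary argument in the
  style of Chebyshev.  The exponent in the theorem is at most \<open>4/5\<close>, so that even \<open>c = 0\<close> is
  admissible.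
\<close>

section \<open>Primes congruent to 1 modulo 4\<close>

definition chi4 :: "nat \<Rightarrow> real" where
  "chi4 m = (if m mod 4 = 1 then 1 else if m mod 4 = 3 then -1 else 0)"

lemma mod_4_cases: "m mod 4 = 0 \<or> m mod 4 = 1 \<or> m mod 4 = 2 \<or> m mod 4 = (3::nat)"
  by presburger

lemma chi4_mult: "chi4 (a * b) = chi4 a * chi4 b"
proof -
  have "chi4 (a * b) = chi4 ((a mod 4) * (b mod 4))"
    by (simp add: chi4_def mod_mult_eq)
  also have "\<dots> = chi4 (a mod 4) * chi4 (b mod 4)"
    using mod_4_cases[of a] mod_4_cases[of b]
    by (elim disjE; simp only:) (simp_all add: chi4_def)
  also have "\<dots> = chi4 a * chi4 b"
    by (simp add: chi4_def)
  finally show ?thesis .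
qed

lemma sum_chi4: "(\<Sum>b=1..n. chi4 b) = (if n mod 4 = 1 \<or> n mod 4 = 2 then 1 else 0)"
proof (induction n)
  case (Suc n)
  then show ?case
    using mod_4_cases[of n] by (auto simp: chi4_def mod_Suc)
qed (simp add: chi4_def)

text \<open>Pairing the terms as \<open>- ln (4 * k + 3) + ln (4 * k + 5)\<close>, which is
  nonnegative, leaves at most one negative term at the end.\<close>

lemma sum_chi4_ln_ge:
  assumes "n \<ge> 1"
  shows "(\<Sum>m=1..n. chi4 m * ln (real m)) \<ge> - ln (real n)"
proof -
  \<comment> \<open>The induction has to track the residue of \<open>n\<close>: the sum is
    nonnegative whenever no negative term is left unpaired.\<close>
  have "(\<Sum>m=1..n. chi4 m * ln (real m)) \<ge> (if n mod 4 = 1 \<or> n mod 4 = 2 then 0 else - ln (real n))"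
    using assms
  proof (induction n rule: nat_induct_at_least)
    case (Suc n)
    have ln: "ln (real n) \<le> ln (real (Suc n))" "ln (real (Suc n)) \<ge> 0"
      using Suc.hyps by auto
    have step: "(\<Sum>m=1..Suc n. chi4 m * ln (real m)) =
        (\<Sum>m=1..n. chi4 m * ln (real m)) + chi4 (Suc n) * ln (real (Suc n))"
      by simp
    have chi4_Suc: "chi4 (Suc n) = (if n mod 4 = 0 then 1 else if n mod 4 = 2 then -1 else 0)"
      by (auto simp: chi4_def mod_Suc)
    show ?case
      unfolding step chi4_Suc using Suc.IH ln mod_4_cases[of n] 
      by (elim disjE) (simp_all add: mod_Suc del: of_nat_Suc ln_le_cancel_iff)
  qed (auto simp: chi4_def)
  moreover have "- ln (real n) \<le> 0"
    using assms by simp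
  ultimately show ?thesis
    by (smt (verit))
qed

section \<open>Chebyshev-type estimates for \<open>mangoldt\<close>\<close>

text \<open>Expand \<open>ln m\<close> as the sum of \<open>mangoldt a\<close> over the divisors
  \<open>a\<close> of \<open>m\<close>, then write \<open>m = a * b\<close> and swap the sums. This
  serves for the constant 1 and for \<open>chi4\<close>.\<close>

lemma sum_mult_ln_eq_mangoldt:
  fixes f :: "nat \<Rightarrow> real"
  shows "(\<Sum>m=1..N. f m * ln (real m)) = (\<Sum>a=1..N. mangoldt a * (\<Sum>b=1..N div a. f (a * b)))"
proof -
  have "(\<Sum>m=1..N. f m * ln (real m)) = (\<Sum>m=1..N. \<Sum>a | a \<in> {1..N} \<and> a dvd m. f m * mangoldt a)"
  proof (intro sum.cong refl)
    fix m assume m: "m \<in> {1..N}"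
    have "{a. a dvd m} = {a. a \<in> {1..N} \<and> a dvd m}"
      using m by (auto dest: dvd_imp_le intro!: Nat.gr0I simp: Suc_le_eq)
    then show "f m * ln (real m) = (\<Sum>a | a \<in> {1..N} \<and> a dvd m. f m * mangoldt a)"
      using m mangoldt_sum[of m, where ?'a = real] by (simp flip: sum_distrib_left)
  qed
  also have "\<dots> = (\<Sum>a=1..N. \<Sum>m | m \<in> {1..N} \<and> a dvd m. f m * mangoldt a)"
    by (rule sum.swap_restrict) auto
  also have "\<dots> = (\<Sum>a=1..N. mangoldt a * (\<Sum>b=1..N div a. f (a * b)))"
  proof (intro sum.cong refl)
    fix a assume a: "a \<in> {1..N}"
    have "(\<Sum>m | m \<in> {1..N} \<and> a dvd m. f m * mangoldt a) = (\<Sum>b=1..N div a. f (a * b) * mangoldt a)"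
      using a by (intro sum.reindex_bij_witness[of _ "\<lambda>b. a * b" "\<lambda>m. m div a"])
        (auto simp: div_le_mono less_eq_div_iff_mult_less_eq mult.commute intro!: Nat.gr0I 
          simp: Suc_le_eq dvd_div_eq_0_iff)
    then show "(\<Sum>m | m \<in> {1..N} \<and> a dvd m. f m * mangoldt a) = mangoldt a * (\<Sum>b=1..N div a. f (a * b))"
      by (simp add: sum_distrib_left mult.commute)
  qed
  finally show ?thesis .
qed

text \<open>Legendre's formula in logarithmic form. The slack in \<open>n \<le> N\<close> adds only
  terms with \<open>n div a = 0\<close> and lets \<open>fact m\<close> and
  \<open>fact (2 * m)\<close> be expanded over one range.\<close>

lemma ln_fact_eq_mangoldt:
  assumes "n \<le> N"
  shows "ln (fact n) = (\<Sum>a=1..N. mangoldt a * real (n div a))"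
proof -
  have "ln (fact n) = (\<Sum>m=1..n. 1 * ln (real m))"
    by (subst fact_prod, subst of_nat_prod, subst ln_prod) auto
  also have "\<dots> = (\<Sum>a=1..n. mangoldt a * real (n div a))"
    unfolding sum_mult_ln_eq_mangoldt[of "\<lambda>_. 1"] by simp
  also have "\<dots> = (\<Sum>a=1..N. mangoldt a * real (n div a))"
    using assms by (intro sum.mono_neutral_left) auto
  finally show ?thesis .
qed

text \<open>Chebyshev's argument: in the logarithm of the central binomial coefficient,
  \<open>mangoldt a\<close> has weight \<open>2 * m div a - 2 * (m div a)\<close>, which is at most
  1, while the coefficient itself is at least \<open>2 ^ m\<close>.\<close>

lemma sum_mangoldt_ge: "real (N div 2) * ln 2 \<le> (\<Sum>a=1..N. mangoldt a)"
proof (cases "N div 2 = 0")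
  case True
  then show ?thesis by (simp add: sum_nonneg mangoldt_nonneg)
next
  case False
  define m where "m = N div 2"
  have m: "m > 0" "2 * m \<le> N"
    using False by (auto simp: m_def)
  \<comment> \<open>This absorbs the denominator of the lower bound \<open>4 ^ m / (2 * m)\<close>
    and leaves \<open>2 ^ m\<close>.\<close>
  have "2 * m \<le> 2 ^ m"
    using m(1) by (induction m rule: nat_induct_non_zero) auto
  then have two_m: "real (2 * m) \<le> 2 ^ m"
    by (metis of_nat_le_iff of_nat_numeral of_nat_power)
  have "2 ^ m * real (2 * m) \<le> 2 ^ m * 2 ^ m"
    using two_m by (intro mult_left_mono) auto
  then have "2 ^ m \<le> 4 ^ m / (2 * real m)"
    using m by (simp add: field_simps flip: power_mult_distrib)
  also have "\<dots> \<le> real (2 * m choose m)"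
    using central_binomial_lower_bound[OF m(1)] by simp
  finally have "ln (2 ^ m) \<le> ln (real (2 * m choose m))"
    by (subst ln_le_cancel_iff) auto
  also have "real (2 * m choose m) = fact (2 * m) / (fact m * fact m)"
    by (subst binomial_fact) auto
  also have "ln \<dots> = ln (fact (2 * m)) - 2 * ln (fact m)"
    by (simp add: ln_div ln_mult)
  also have "\<dots> = (\<Sum>a=1..N. mangoldt a * real (2 * m div a)) - 2 * (\<Sum>a=1..N. mangoldt a * real (m div a))"
    using m ln_fact_eq_mangoldt[of "2 * m" N] ln_fact_eq_mangoldt[of m N] by simp
  also have "\<dots> = (\<Sum>a=1..N. mangoldt a * (real (2 * m div a) - 2 * real (m div a)))"
    by (simp add: sum_distrib_left sum_subtractf algebra_simps)
  also have "\<dots> \<le> (\<Sum>a=1..N. mangoldt a * 1)"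
  proof (intro sum_mono mult_left_mono mangoldt_nonneg)
    fix a assume "a \<in> {1..N}"
    then have "2 * m < (2 * (m div a) + 2) * a"
      using dividend_less_times_div[of a m] by (simp add: algebra_simps)
    then have "2 * m div a < 2 * (m div a) + 2"
      by (rule less_mult_imp_div_less)
    then show "real (2 * m div a) - 2 * real (m div a) \<le> 1"
      by linarith
  qed
  finally show ?thesis
    by (simp add: m_def ln_realpow)
qed

text \<open>
  Up to an error \<open>ln x\<close>, the non-principal character balances the classes 1 and 3 modulo 4 in
  \<open>W x = (\<Sum>odd a. mangoldt a * S (x div a))\<close>, where \<open>S y = (\<Sum>b\<le>y. chi4 b)\<close>.  As \<open>S y = 1\<close> for \<open>y\<close>
  in \<open>{1, 2}\<close> and \<open>S \<ge> 0\<close>, the sum of \<open>W (N div 3 ^ j)\<close> over \<open>j < J\<close> counts every odd prime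
  power up to \<open>N\<close>.
\<close>

lemma sum_mangoldt_odd_le:
  assumes "N \<ge> 1" "N < 3 ^ J"
  shows "(\<Sum>a | a \<in> {1..N} \<and> odd a. mangoldt a) \<le>
    real J * (2 * (\<Sum>a | a \<in> {1..N} \<and> a mod 4 = 1. mangoldt a) + ln (real N))"
proof -
  define S where "S = (\<lambda>n::nat. if n mod 4 = 1 \<or> n mod 4 = 2 then 1 else (0::real))"
  define O1 where "O1 = {a \<in> {1..N}. a mod 4 = 1}"
  define O3 where "O3 = {a \<in> {1..N}. a mod 4 = 3}"
  have odd: "{a \<in> {1..N}. odd a} = O1 \<union> O3" 
    unfolding O1_def O3_def by (auto; presburger)
  have disj: "O1 \<inter> O3 = {}" and fin: "finite O1" "finite O3"
    by (auto simp: O1_def O3_def)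
  define \<psi> where "\<psi> = (\<Sum>a\<in>O1. mangoldt a :: real)"
  \<comment> \<open>The lower bound for the \<open>chi4\<close> sum limits the \<open>O3\<close>
    part to the \<open>O1\<close> part plus \<open>ln N\<close>; the \<open>O1\<close> part is at
    most \<open>\<psi>\<close> as \<open>S\<close> is at most 1.\<close>
  have step: "(\<Sum>a\<in>O1 \<union> O3. mangoldt a * S (x div a)) \<le> 2 * \<psi> + ln (real N)" if "x \<le> N" for x
  proof (cases "x = 0")
    case True
    then show ?thesis
      using assms by (simp add: S_def \<psi>_def sum_nonneg mangoldt_nonneg)
  next
    case False
    have "- ln (real N) \<le> - ln (real x)"
      using False that by simp
    also have "\<dots> \<le> (\<Sum>m=1..x. chi4 m * ln (real m))"
      using False by (intro sum_chi4_ln_ge) auto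
    also have "\<dots> = (\<Sum>a=1..x. mangoldt a * (chi4 a * S (x div a)))"
      unfolding sum_mult_ln_eq_mangoldt chi4_mult sum_distrib_left[symmetric] sum_chi4 S_def ..
    also have "\<dots> = (\<Sum>a=1..N. mangoldt a * (chi4 a * S (x div a)))"
      using that by (intro sum.mono_neutral_left) (auto simp: S_def)
    also have "\<dots> = (\<Sum>a\<in>O1 \<union> O3. mangoldt a * (chi4 a * S (x div a)))"
      by (intro sum.mono_neutral_right) (auto simp: O1_def O3_def chi4_def)
    also have "\<dots> = (\<Sum>a\<in>O1. mangoldt a * S (x div a)) - (\<Sum>a\<in>O3. mangoldt a * S (x div a))"
      using fin disj by (subst sum.union_disjoint) (auto simp: O1_def O3_def chi4_def sum_negf)
    finally have "(\<Sum>a\<in>O3. mangoldt a * S (x div a)) \<le> (\<Sum>a\<in>O1. mangoldt a * S (x div a)) + ln (real N)"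
      by simp
    moreover have "(\<Sum>a\<in>O1. mangoldt a * S (x div a)) \<le> (\<Sum>a\<in>O1. mangoldt a * 1)"
      by (intro sum_mono mult_left_mono mangoldt_nonneg) (auto simp: S_def)
    ultimately show ?thesis
      using fin disj by (subst sum.union_disjoint) (auto simp: \<psi>_def)
  qed
  have S_nonneg: "S n \<ge> 0" for n
    by (simp add: S_def)
  \<comment> \<open>Repeated division of \<open>n\<close> by 3 passes through 1 or 2 before it
    reaches 0.\<close>
  have covered: "1 \<le> (\<Sum>j<J. S (n div 3 ^ j))" if "1 \<le> n" "n < 3 ^ J" for n
    using that
  proof (induction J arbitrary: n)
    case (Suc J)
    show ?case
    proof (cases "n < 3")
      case True
      then have "S n = 1"
        using Suc.prems by (auto simp: S_def)
      then show ?thesis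
        by (simp add: sum.lessThan_Suc_shift S_nonneg sum_nonneg del: sum.lessThan_Suc)
    next
      case False
      then have "1 \<le> (\<Sum>j<J. S (n div 3 div 3 ^ j))"
        using Suc.prems by (intro Suc.IH) (auto simp: less_mult_imp_div_less)
      also have "\<dots> = (\<Sum>j<J. S (n div 3 ^ Suc j))"
        by (simp add: div_mult2_eq)
      finally show ?thesis
        unfolding sum.lessThan_Suc_shift using S_nonneg[of "n div 3 ^ 0"] by linarith
    qed
  qed auto
  have "(\<Sum>a\<in>O1 \<union> O3. mangoldt a) \<le> (\<Sum>a\<in>O1 \<union> O3. mangoldt a * (\<Sum>j<J. S (N div a div 3 ^ j)))"
  proof (intro sum_mono)
    fix a assume "a \<in> O1 \<union> O3"
    then have "1 \<le> N div a" "N div a < 3 ^ J"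
      using assms by (auto simp: O1_def O3_def less_eq_div_iff_mult_less_eq intro: le_less_trans[OF div_le_dividend])
    then have "mangoldt a * 1 \<le> mangoldt a * (\<Sum>j<J. S (N div a div 3 ^ j))"
      by (intro mult_left_mono covered mangoldt_nonneg)
    then show "mangoldt a \<le> mangoldt a * (\<Sum>j<J. S (N div a div 3 ^ j))"
      by simp
  qed
  also have "\<dots> = (\<Sum>j<J. \<Sum>a\<in>O1 \<union> O3. mangoldt a * S (N div 3 ^ j div a))"
    unfolding sum_distrib_left by (subst sum.swap) (simp add: mult.commute flip: div_mult2_eq)
  also have "\<dots> \<le> (\<Sum>j<J. 2 * \<psi> + ln (real N))"
    by (intro sum_mono step) auto
  finally show ?thesis
    by (simp only: odd \<psi>_def O1_def) simp
qed

text \<open>Off the primes only powers \<open>p ^ k\<close> with \<open>k \<ge> 2\<close>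
  contribute. They have \<open>p \<le> sqrt N\<close> and \<open>k \<le> log 2 N\<close>, and each
  contributes at most \<open>ln N\<close>.\<close>

lemma sum_mangoldt_not_prime_le:
  fixes N :: nat
  assumes "N \<ge> 1"
  shows "(\<Sum>a | a \<in> {1..N} \<and> \<not> prime a. mangoldt a) \<le> sqrt N * log 2 N * ln N"
proof -
  define A where "A = {a \<in> {1..N}. \<not> prime a \<and> primepow a}"
  define B where "B = {1..nat \<lfloor>sqrt N\<rfloor>} \<times> {1..nat \<lfloor>log 2 N\<rfloor>}"
  have "A \<subseteq> (\<lambda>(p, k). p ^ k) ` B"
  proof
    fix a assume a: "a \<in> A"
    then obtain p k :: nat where pk: "prime p" "k > 0" "a = p ^ k"
      by (auto simp: A_def primepow_def)
    have "k \<noteq> 1"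
      using a pk by (auto simp: A_def)
    with pk have "k \<ge> 2" by simp
    have p: "p \<ge> 2" 
      by (rule prime_ge_2_nat[OF pk(1)])
    have "p ^ 2 \<le> p ^ k"
      using p \<open>k \<ge> 2\<close> by (intro power_increasing) auto
    then have "p ^ 2 \<le> N"
      using a pk by (simp add: A_def)
    then have "real p ^ 2 \<le> real N"
      by (metis of_nat_le_iff of_nat_power)
    then have "real p \<le> sqrt N"
      by (rule real_le_rsqrt)
    then have p_le: "p \<le> nat \<lfloor>sqrt N\<rfloor>"
      by linarith
    have "2 ^ k \<le> p ^ k"
      using p by (rule power_mono) auto
    also have "\<dots> \<le> N"
      using a pk by (simp add: A_def)
    finally have "2 ^ k \<le> N" .
    then have "real k \<le> log 2 N"
      using assms by (subst le_log_iff) (simp_all add: powr_realpow flip: of_nat_le_iff)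
    then have "k \<le> nat \<lfloor>log 2 N\<rfloor>"
      by linarith
    then show "a \<in> (\<lambda>(p, k). p ^ k) ` B"
      using pk p p_le by (auto simp: B_def intro!: image_eqI[of _ _ "(p, k)"])
  qed
  then have "card A \<le> card B"
    by (rule surj_card_le[rotated]) (auto simp: B_def)
  also have "card B = nat \<lfloor>sqrt N\<rfloor> * nat \<lfloor>log 2 N\<rfloor>"
    by (simp add: B_def)
  finally have "real (card A) \<le> real (nat \<lfloor>sqrt N\<rfloor> * nat \<lfloor>log 2 N\<rfloor>)"
    by (rule of_nat_mono)
  also have "\<dots> \<le> sqrt N * log 2 N"
    unfolding of_nat_mult using assms by (intro mult_mono) (auto simp: of_nat_nat)
  finally have card: "real (card A) \<le> sqrt N * log 2 N" .
  have "(\<Sum>a | a \<in> {1..N} \<and> \<not> prime a. mangoldt a) = (\<Sum>a\<in>A. mangoldt a :: real)"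
    by (intro sum.mono_neutral_right) (auto simp: A_def mangoldt_def)
  also have "\<dots> \<le> (\<Sum>a\<in>A. ln N)"
  proof (intro sum_mono)
    fix a assume "a \<in> A"
    then show "mangoldt a \<le> ln N"
      using mangoldt_le[of a] ln_le_cancel_iff[of a N] by (auto simp: A_def simp del: ln_le_cancel_iff)
  qed
  also have "\<dots> \<le> sqrt N * log 2 N * ln N"
    using card assms by (auto intro: mult_right_mono)
  finally show ?thesis .
qed

text \<open>Otherwise all primes up to \<open>N\<close> in the class 1 modulo 4 lie below
  \<open>N powr (4/5)\<close>. This class then carries too little weight and, by
  \<open>sum_mangoldt_odd_le\<close>, so do all odd numbers, against \<open>sum_mangoldt_ge\<close>.
  The argument works for any exponent below 1.\<close>

lemma eventually_prime_1_mod_4: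
  "eventually (\<lambda>N::nat. \<exists>p. prime p \<and> p mod 4 = 1 \<and> p \<le> N \<and> real N powr (4/5) \<le> real p) at_top"
proof -
  define E where "E = (\<lambda>x::real. sqrt x * log 2 x * ln x)"
  \<comment> \<open>On the left is the upper bound for the sum of \<open>mangoldt\<close> that the
    absence of such a prime forces, on the right Chebyshev's lower bound.\<close>
  have "eventually (\<lambda>x::real. E x + ln x + (ln x + 1) * (2 * (x powr (4/5) * ln x + E x) + ln x) 
           < (x / 2 - 1) * ln 2) at_top"
    unfolding E_def by real_asymp
  then have "eventually (\<lambda>N::nat. E N + ln N + (ln N + 1) * (2 * (N powr (4/5) * ln N + E N) + ln N) 
           < (N / 2 - 1) * ln 2) at_top"
    by (rule eventually_compose_filterlim[OF _ filterlim_real_sequentially])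
  moreover have "eventually (\<lambda>N::nat. N \<ge> 2) at_top"
    by (rule eventually_ge_at_top)
  ultimately show ?thesis
  proof eventually_elim
    case (elim N)
    note large = elim(1) and N = elim(2)
    show ?case
    proof (rule ccontr)
      assume none: "\<not> ?case"
      define P where "P = {p \<in> {1..N}. p mod 4 = 1 \<and> prime p}"
      define C where "C = {a \<in> {1..N}. \<not> prime a}"
      have C: "(\<Sum>a\<in>C. mangoldt a) \<le> E N"
        using sum_mangoldt_not_prime_le[of N] N by (simp add: C_def E_def)
      have "(\<Sum>a | a \<in> {1..N} \<and> a mod 4 = 1. mangoldt a :: real) \<le> (\<Sum>a\<in>P \<union> C. mangoldt a)"
        by (intro sum_mono2 mangoldt_nonneg) (auto simp: P_def C_def)
      also have "\<dots> = (\<Sum>a\<in>P. mangoldt a) + (\<Sum>a\<in>C. mangoldt a)"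
        by (intro sum.union_disjoint) (auto simp: P_def C_def)
      also have "(\<Sum>a\<in>P. mangoldt a) \<le> (\<Sum>a\<in>P. ln N)"
      proof (intro sum_mono)
        fix a assume "a \<in> P"
        then show "mangoldt a \<le> ln N"
          using prime_gt_0_nat[of a] by (auto simp: P_def)
      qed
      also have "\<dots> = real (card P) * ln N"
        by simp
      also have "\<dots> \<le> N powr (4/5) * ln N"
      proof (intro mult_right_mono)
        have "P \<subseteq> {1..nat \<lfloor>N powr (4/5)\<rfloor>}"
        proof
          fix p assume "p \<in> P"
          then have "prime p" "p mod 4 = 1" "p \<le> N" "p \<ge> 1"
            by (auto simp: P_def)
          then have "real p < N powr (4/5)"
            using none not_le by blast
          then have "int p \<le> \<lfloor>N powr (4/5)\<rfloor>"
            by (simp add: le_floor_iff)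
          then show "p \<in> {1..nat \<lfloor>N powr (4/5)\<rfloor>}"
            using \<open>p \<ge> 1\<close> by simp
        qed
        then have "card P \<le> card {1..nat \<lfloor>N powr (4/5)\<rfloor>}"
          by (intro card_mono) auto
        also have "\<dots> = nat \<lfloor>N powr (4/5)\<rfloor>"
          by simp
        finally have "real (card P) \<le> real (nat \<lfloor>N powr (4/5)\<rfloor>)"
          by (rule of_nat_mono)
        also have "\<dots> \<le> N powr (4/5)"
          by (simp add: of_nat_nat)
        finally show "real (card P) \<le> N powr (4/5)" .
      qed (use N in auto)
      finally have psi1: "(\<Sum>a | a \<in> {1..N} \<and> a mod 4 = 1. mangoldt a) \<le> N powr (4/5) * ln N + E N"
        using C by simp
      \<comment> \<open>Since \<open>exp 1 \<le> 3\<close>, \<open>ln N < J\<close> yields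
        \<open>N < 3 ^ J\<close>, while \<open>J \<le> ln N + 1\<close> keeps the loss
        logarithmic.\<close>
      define J where "J = nat \<lfloor>ln N\<rfloor> + 1"
      have "real J = of_int \<lfloor>ln N\<rfloor> + 1"
        using N by (simp add: J_def of_nat_nat)
      then have J_le: "real J \<le> ln N + 1" and J_ge: "ln N < real J"
        by linarith+
      have "real N < exp (real J)"
        using J_ge N by (metis exp_ln exp_less_cancel_iff of_nat_0_less_iff less_le_trans zero_less_numeral)
      also have "\<dots> = exp 1 ^ J"
        by (simp flip: exp_of_nat_mult)
      also have "\<dots> \<le> 3 ^ J"
        by (intro power_mono exp_le) auto
      finally have "N < 3 ^ J"
        by (metis of_nat_less_iff of_nat_numeral of_nat_power)
      have "(N / 2 - 1) * ln 2 \<le> real (N div 2) * ln 2"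
        by (intro mult_right_mono) auto
      also have "\<dots> \<le> (\<Sum>a=1..N. mangoldt a)"
        by (rule sum_mangoldt_ge)
      \<comment> \<open>An even number is 2 or not prime, so the even part adds at most
        \<open>ln 2 + E N\<close>.\<close>
      also have "\<dots> \<le> (\<Sum>a\<in>{a \<in> {1..N}. odd a} \<union> insert 2 C. mangoldt a)"
        by (intro sum_mono2 mangoldt_nonneg) (auto simp: C_def dest: primes_dvd_imp_eq[OF two_is_prime_nat])
      also have "\<dots> \<le> (\<Sum>a | a \<in> {1..N} \<and> odd a. mangoldt a) + (\<Sum>a\<in>insert 2 C. mangoldt a)"
        by (subst sum.union_inter [symmetric]) (auto simp: C_def sum_nonneg mangoldt_nonneg)
      also have "(\<Sum>a\<in>insert 2 C. mangoldt a) = ln 2 + (\<Sum>a\<in>C. mangoldt a :: real)"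
        by (subst sum.insert) (auto simp: C_def)
      also have "\<dots> \<le> ln N + E N"
        using C N by (intro add_mono) auto
      also have "(\<Sum>a | a \<in> {1..N} \<and> odd a. mangoldt a) \<le> 
          real J * (2 * (\<Sum>a | a \<in> {1..N} \<and> a mod 4 = 1. mangoldt a) + ln N)"
        using N \<open>N < 3 ^ J\<close> by (intro sum_mangoldt_odd_le) auto
      also have "\<dots> \<le> (ln N + 1) * (2 * (N powr (4/5) * ln N + E N) + ln N)"
        using N psi1 J_le
        by (intro mult_mono add_mono mult_left_mono)
          (auto intro!: add_nonneg_nonneg mult_nonneg_nonneg sum_nonneg mangoldt_nonneg)
      finally show False
        using large by simp
    qed
  qed
qed

section \<open>A curve meeting every sphere in few points\<close>

text \<open>Over the field with \<open>p\<close> elements, a polynomial with more roots than its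
  degree is zero. The induction splits off the linear factor of a root \<open>t\<close>, where the
  remainder \<open>poly f t\<close> is a multiple of \<open>p\<close>.\<close>

lemma prime_dvd_coeff_if_many_roots:
  fixes f :: "int poly" and p :: int
  assumes "prime p" "finite T" "degree f < card T"
    and "\<And>t. t \<in> T \<Longrightarrow> p dvd poly f t"
    and "\<And>s t. s \<in> T \<Longrightarrow> t \<in> T \<Longrightarrow> p dvd s - t \<Longrightarrow> s = t"
  shows "p dvd coeff f k"
  using assms(2-)
proof (induction "degree f" arbitrary: f T k rule: less_induct)
  case less
  then obtain t where t: "t \<in> T"
    by fastforce
  define q where "q = synthetic_div f t"
  have f: "f = [:-t, 1:] * q + [:poly f t:]"
    unfolding q_def by (rule synthetic_div_correct'[symmetric])
  show ?case
  proof (cases "degree f = 0")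
    case True
    then obtain c where "f = [:c:]"
      by (rule degree_eq_zeroE)
    then show ?thesis
      using less.prems(3)[OF t] by (auto simp: coeff_pCons split: nat.split)
  next
    case False
    have q: "p dvd coeff q k" for k
    proof (rule less.hyps[of q "T - {t}"])
      show "p dvd poly q s" if s: "s \<in> T - {t}" for s
      proof -
        have "poly f s = (s - t) * poly q s + poly f t"
          by (subst f) (simp add: algebra_simps)
        then have "p dvd (s - t) * poly q s"
          using less.prems(3) s t by (metis Diff_iff dvd_add_left_iff)
        moreover have "\<not> p dvd s - t"
          using less.prems(4)[of s t] s t by auto
        ultimately show ?thesis
          using assms(1) by (simp add: prime_dvd_mult_iff)
      qed
    qed (use False less.prems t in \<open>auto simp: q_def degree_synthetic_div\<close>)
    show ?thesis
      using less.prems(3)[OF t] q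
      by (subst f) (auto simp: coeff_pCons split: nat.split)
  qed
qed

text \<open>A real kernel vector makes the integer determinant vanish, so there is an integer kernel
  vector; dividing it by the gcd of its entries makes it nonzero modulo \<open>p\<close>.\<close>

lemma int_kernel_not_dvd_if_real_kernel:
  fixes M :: "nat \<Rightarrow> nat \<Rightarrow> int" and c :: "nat \<Rightarrow> real" and p :: int
  assumes "\<not> is_unit p" "\<exists>k<n. c k \<noteq> 0"
    and "\<forall>r<n. (\<Sum>k<n. of_int (M r k) * c k) = 0"
  shows "\<exists>w :: nat \<Rightarrow> int. (\<exists>k<n. \<not> p dvd w k) \<and> (\<forall>r<n. (\<Sum>k<n. M r k * w k) = 0)"
proof -
  define A where "A = mat n n (\<lambda>(r, k). M r k)"
  define A' where "A' = (map_mat of_int A :: real mat)"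
  have A: "A \<in> carrier_mat n n" and A': "A' \<in> carrier_mat n n"
    by (auto simp: A_def A'_def)
  have "A' *\<^sub>v vec n c = 0\<^sub>v n"
    using assms(3) by (intro eq_vecI) 
      (auto simp: A_def A'_def scalar_prod_def atLeast0LessThan)
  moreover have "vec n c \<noteq> 0\<^sub>v n"
    using assms(2) by (metis index_vec index_zero_vec(1))
  ultimately have "det A' = 0"
    using det_0_iff_vec_prod_zero[OF A'] vec_carrier by blast
  then have "det A = 0"
    by (simp add: A'_def of_int_hom.hom_det)
  then obtain v where v: "v \<in> carrier_vec n" "v \<noteq> 0\<^sub>v n" "A *\<^sub>v v = 0\<^sub>v n"
    using det_0_iff_vec_prod_zero[OF A] by auto
  define g where "g = Gcd ((\<lambda>k. v $ k) ` {..<n})"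
  define w where "w = (\<lambda>k. v $ k div g)"
  have v_eq: "v $ k = g * w k" if "k < n" for k
    using that by (simp add: w_def g_def Gcd_dvd)
  obtain k where k: "k < n" "v $ k \<noteq> 0"
    using v by (metis carrier_vecD eq_vecI index_zero_vec)
  then have "g \<noteq> 0"
    using v_eq by fastforce
  show ?thesis
  proof (intro exI[of _ w] conjI allI impI)
    show "\<exists>k<n. \<not> p dvd w k"
    proof (rule ccontr)
      assume "\<not> ?thesis"
      then have "g * p dvd v $ k" if "k < n" for k
        using that by (auto simp: v_eq intro: mult_dvd_mono)
      then have "g * p dvd Gcd ((\<lambda>k. v $ k) ` {..<n})"
        by (intro Gcd_greatest) auto
      then have "g * p dvd g * 1"
        by (simp add: g_def)
      then show False
        using \<open>g \<noteq> 0\<close> assms(1) by simp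
    qed
  next
    fix r assume r: "r < n"
    then have "(A *\<^sub>v v) $ r = 0"
      using v by simp
    then have "(\<Sum>k<n. M r k * v $ k) = 0"
      using r v(1) by (simp add: A_def scalar_prod_def atLeast0LessThan)
    then have "g * (\<Sum>k<n. M r k * w k) = 0"
      unfolding sum_distrib_left by (simp add: v_eq mult.left_commute)
    then show "(\<Sum>k<n. M r k * w k) = 0"
      using \<open>g \<noteq> 0\<close> by simp
  qed
qed

text \<open>Expanding the squared distance puts round spheres and hyperplanes into one linear
  family, with \<open>c (Suc d)\<close> equal to 1 or 0. Thus \<open>d + 2\<close> points give a
  square linear system for \<open>c\<close>.\<close>

lemma is_sphere_equation:
  assumes "is_sphere d S"
  obtains c :: "nat \<Rightarrow> real" where "\<exists>k<d+2. c k \<noteq> 0"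
    "\<And>x. x \<in> S \<Longrightarrow> c 0 + (\<Sum>i<d. c (Suc i) * x i) + c (Suc d) * (\<Sum>i<d. (x i)\<^sup>2) = 0"
  using assms unfolding is_sphere_def
proof
  assume "is_round_sphere d S"
  then obtain z r where S: "S = {x \<in> real_space d. (\<Sum>i<d. (x i - z i)\<^sup>2) = r\<^sup>2}"
    by (auto simp: is_round_sphere_def)
  define c where "c = (\<lambda>k. if k = 0 then (\<Sum>i<d. (z i)\<^sup>2) - r\<^sup>2 else if k = Suc d then 1 else - 2 * z (k - 1))"
  show thesis
  proof (rule that[of c])
    show "\<exists>k<d+2. c k \<noteq> 0"
      by (intro exI[of _ "Suc d"]) (auto simp: c_def)
    show "c 0 + (\<Sum>i<d. c (Suc i) * x i) + c (Suc d) * (\<Sum>i<d. (x i)\<^sup>2) = 0" if "x \<in> S" for x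
    proof -
      have "(\<Sum>i<d. (x i - z i)\<^sup>2) = (\<Sum>i<d. (z i)\<^sup>2) + (\<Sum>i<d. c (Suc i) * x i) + (\<Sum>i<d. (x i)\<^sup>2)"
        unfolding sum.distrib[symmetric] by (intro sum.cong) (auto simp: c_def power2_eq_square algebra_simps)
      then show ?thesis
        using that by (simp add: S c_def)
    qed
  qed
next
  assume "is_hyperplane d S"
  then obtain a b where ab: "\<exists>i<d. a i \<noteq> 0" "S = {x \<in> real_space d. (\<Sum>i<d. a i * x i) = b}"
    by (auto simp: is_hyperplane_def)
  define c where "c = (\<lambda>k. if k = 0 then - b else if k = Suc d then 0 else a (k - 1))"
  show thesis
  proof (rule that[of c])
    obtain i where "i < d" "a i \<noteq> 0"
      using ab by auto
    then show "\<exists>k<d+2. c k \<noteq> 0"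
      by (intro exI[of _ "Suc i"]) (auto simp: c_def)
    show "c 0 + (\<Sum>i<d. c (Suc i) * x i) + c (Suc d) * (\<Sum>i<d. (x i)\<^sup>2) = 0" if "x \<in> S" for x
      using that by (simp add: ab c_def)
  qed
qed

section \<open>The curve and its linear relations modulo \<open>p\<close>\<close>

definition curve :: "nat \<Rightarrow> int \<Rightarrow> int \<Rightarrow> nat \<Rightarrow> int" where
  "curve d I t i = t ^ Suc i + I * t ^ (d - i)"

text \<open>The exponents \<open>Suc i\<close> and \<open>d - i\<close> add up to
  \<open>Suc d\<close>, so all cross terms agree. The pure squares give the same even powers twice,
  in opposite order, with weights 1 and \<open>I\<^sup>2\<close>; they cancel once
  \<open>I\<^sup>2\<close> is -1.\<close>

lemma sum_curve_squares:
  "(\<Sum>i<d. (curve d I t i)\<^sup>2) = (1 + I\<^sup>2) * (\<Sum>i<d. t ^ (2 * Suc i)) + 2 * int d * I * t ^ Suc d"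
proof -
  have "(\<Sum>i<d. (curve d I t i)\<^sup>2) = (\<Sum>i<d. t ^ (2 * Suc i) + I\<^sup>2 * t ^ (2 * Suc (d - Suc i)) + 2 * I * t ^ Suc d)"
  proof (intro sum.cong refl)
    fix i assume i: "i \<in> {..<d}"
    have "t ^ Suc i * t ^ (d - i) = t ^ Suc d"
      using i by (simp flip: power_add)
    then have "(curve d I t i)\<^sup>2 = (t ^ Suc i)\<^sup>2 + I\<^sup>2 * (t ^ (d - i))\<^sup>2 + 2 * I * t ^ Suc d"
      by (simp add: curve_def power2_sum power_mult_distrib mult.left_commute del: power_Suc)
    moreover have "d - i = Suc (d - Suc i)"
      using i by auto
    ultimately show "(curve d I t i)\<^sup>2 = t ^ (2 * Suc i) + I\<^sup>2 * t ^ (2 * Suc (d - Suc i)) + 2 * I * t ^ Suc d"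
      by (simp only: mult.commute[of 2] power_mult)
  qed
  also have "\<dots> = (\<Sum>i<d. t ^ (2 * Suc i)) + I\<^sup>2 * (\<Sum>i<d. t ^ (2 * Suc (d - Suc i))) + 2 * int d * I * t ^ Suc d"
    by (simp add: sum.distrib sum_distrib_left del: power_Suc mult_Suc_right)
  also have "(\<Sum>i<d. t ^ (2 * Suc (d - Suc i))) = (\<Sum>i<d. t ^ (2 * Suc i))"
    by (rule sum.nat_diff_reindex)
  finally show ?thesis
    by (simp add: algebra_simps del: power_Suc mult_Suc_right)
qed

text \<open>The relation becomes a polynomial of degree at most \<open>d + 1\<close> with
  \<open>d + 2\<close> roots modulo \<open>p\<close>, so its coefficients vanish. They determine
  \<open>w\<close> because 2, \<open>2 * d\<close> and \<open>I\<close> are invertible modulo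
  \<open>p\<close>.\<close>

lemma curve_relation_trivial:
  fixes w :: "nat \<Rightarrow> int" and p :: int
  assumes p: "prime p" "p > 2 * int d" and I: "[I\<^sup>2 = -1] (mod p)" and "d \<ge> 1"
    and T: "finite T" "card T = d + 2" "\<And>s t. s \<in> T \<Longrightarrow> t \<in> T \<Longrightarrow> p dvd s - t \<Longrightarrow> s = t"
    and rel: "\<And>t. t \<in> T \<Longrightarrow> [w 0 + (\<Sum>i<d. w (Suc i) * curve d I t i) + 
      w (Suc d) * (\<Sum>i<d. (curve d I t i)\<^sup>2) = 0] (mod p)"
    and k: "k < d + 2"
  shows "p dvd w k"
proof -
  \<comment> \<open>The squared norm enters only through \<open>2 * d * I * t ^ Suc d\<close>, to
    which it reduces modulo \<open>p\<close>.\<close>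
  define f where "f = monom (w 0) 0 + (\<Sum>i<d. monom (w (Suc i)) (Suc i) + monom (I * w (Suc i)) (d - i))
    + monom (2 * int d * I * w (Suc d)) (Suc d)"
  have p_I: "p dvd I\<^sup>2 + 1"
    using I by (simp add: cong_iff_dvd_diff)
  have not_dvd_I: "\<not> p dvd I"
    using p_I p(1) by (metis dvd_add_right_iff dvd_power dvd_trans not_prime_unit zero_less_numeral)
  have not_dvd_less: "\<not> p dvd int m" if "0 < m" "m \<le> 2 * d" for m
    using that p by (auto dest!: zdvd_imp_le)
  have coeff: "p dvd coeff f j" for j
  proof (rule prime_dvd_coeff_if_many_roots[OF p(1) T(1) _ _ T(3)])
    have "degree f \<le> Suc d"
      unfolding f_def by (intro degree_add_le degree_sum_le order_trans[OF degree_monom_le]) auto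
    then show "degree f < card T"
      using T by simp
    show "p dvd poly f t" if t: "t \<in> T" for t
    proof -
      have "poly f t = w 0 + (\<Sum>i<d. w (Suc i) * curve d I t i) + w (Suc d) * (2 * int d * I * t ^ Suc d)"
        by (simp add: f_def poly_sum poly_monom curve_def algebra_simps)
      also have "\<dots> = w 0 + (\<Sum>i<d. w (Suc i) * curve d I t i) + w (Suc d) * (\<Sum>i<d. (curve d I t i)\<^sup>2)
          - w (Suc d) * (1 + I\<^sup>2) * (\<Sum>i<d. t ^ (2 * Suc i))"
        unfolding sum_curve_squares by (simp only: algebra_simps)
      finally show ?thesis
        using rel[OF t] p_I by (simp add: cong_iff_dvd_diff add.commute)
    qed
  qed 
  have coeff_0: "coeff f 0 = w 0"
    by (simp add: f_def coeff_sum)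
  \<comment> \<open>The first term comes from the index \<open>i\<close>, the second from
    \<open>j = d - Suc i\<close>, for which \<open>Suc j = d - i\<close>.\<close>
  have coeff_mid: "coeff f (Suc i) = w (Suc i) + I * w (d - i)" if "i < d" for i
  proof -
    have "(\<Sum>j<d. if Suc j = Suc i then w (Suc j) else 0) = w (Suc i)"
      using that by simp
    moreover have "(\<Sum>j<d. if d - j = Suc i then I * w (Suc j) else 0) =
        (\<Sum>j<d. if j = d - Suc i then I * w (Suc j) else 0)"
      using that by (intro sum.cong) auto
    then have "(\<Sum>j<d. if d - j = Suc i then I * w (Suc j) else 0) = I * w (d - i)"
      using that by (simp add: Suc_diff_Suc)
    ultimately show ?thesis
      using that by (simp add: f_def coeff_sum sum.distrib)
  qed
  have "d - i \<noteq> Suc d" for i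
    by simp
  then have coeff_top: "coeff f (Suc d) = 2 * int d * I * w (Suc d)"
    by (simp add: f_def coeff_sum)
  consider "k = 0" | i where "k = Suc i" "i < d" | "k = Suc d"
    using k by (metis Suc_lessI add_2_eq_Suc' less_Suc_eq not0_implies_Suc Suc_less_eq)
  then show ?thesis
  proof cases
    case 1
    then show ?thesis using coeff[of 0] coeff_0 by simp
  next
    case 2
    define j where "j = d - Suc i"
    have j: "j < d" "d - i = Suc j" "d - j = Suc i"
      using 2 by (auto simp: j_def)
    have ij: "p dvd w (Suc i) + I * w (Suc j)" and ji: "p dvd w (Suc j) + I * w (Suc i)"
      using coeff[of "Suc i"] coeff[of "Suc j"] coeff_mid[of i] coeff_mid[of j] 2 j by simp_all
    \<comment> \<open>The two coefficient conditions form a 2 by 2 system of determinant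
      \<open>1 - I\<^sup>2\<close>, which is 2 modulo \<open>p\<close>.\<close>
    have "p dvd (w (Suc i) + I * w (Suc j)) - I * (w (Suc j) + I * w (Suc i)) + (I\<^sup>2 + 1) * w (Suc i)"
      by (rule dvd_add[OF dvd_diff[OF ij dvd_mult[OF ji]] dvd_mult2[OF p_I]])
    also have "\<dots> = int 2 * w (Suc i)"
      by (simp add: algebra_simps power2_eq_square)
    finally show ?thesis
      using p(1) not_dvd_less[of 2] 2 \<open>d \<ge> 1\<close> by (simp add: prime_dvd_mult_iff)
  next
    case 3
    have "p dvd int (2 * d) * I * w (Suc d)"
      using coeff[of "Suc d"] coeff_top by simp
    moreover have "\<not> p dvd int (2 * d)"
      using \<open>d \<ge> 1\<close> by (intro not_dvd_less) auto
    ultimately show ?thesis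
      using 3 not_dvd_I by (simp only: prime_dvd_mult_iff[OF p(1)]) simp
  qed
qed

section \<open>The reduced curve in the grid\<close>

text \<open>A cospherical set of \<open>d + 2\<close> points on the reduced curve yields a real
  kernel vector, then an integer one that is nonzero modulo \<open>p\<close>, against
  \<open>curve_relation_trivial\<close>.\<close>

lemma f_sph_ge_prime:
  fixes p d n :: nat
  assumes p: "prime p" "p mod 4 = 1" "2 * d < p" "p \<le> n" and d: "d \<ge> 1"
  shows "p \<le> f_sph n d"
proof -
  have p_int: "prime (int p)" "int p > 2 * int d"
    using p by auto
  have "p > 2"
    using p(2) prime_ge_2_nat[OF p(1)] by (cases "p = 2") auto
  have even: "even ((p - 1) div 2)"
    using p(2) by presburger
  \<comment> \<open>By Euler's criterion -1 is a square modulo \<open>p\<close>, as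
    \<open>(p - 1) div 2\<close> is even.\<close>
  have "[Legendre (-1) (int p) = (-1) ^ ((p - 1) div 2)] (mod int p)"
    using p(1) \<open>p > 2\<close> by (intro euler_criterion)
  then have "[Legendre (-1) (int p) = 1] (mod int p)"
    using even by simp
  then have "QuadRes (int p) (-1)"
    using \<open>p > 2\<close> by (auto simp: Legendre_def cong_iff_dvd_diff split: if_splits dest: zdvd_imp_le)
  then obtain I where I: "[I\<^sup>2 = -1] (mod int p)"
    by (auto simp: QuadRes_def)
  \<comment> \<open>The shift by 1 places the residues in \<open>{1..p}\<close>, because the grid
    begins at 1.\<close>
  define X where "X = (\<lambda>t i. (curve d I t i - 1) mod int p + 1)"
  define pt where "pt = (\<lambda>t. restrict (\<lambda>i. real_of_int (X t i)) {..<d})"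
  have X_cong: "[X t i = curve d I t i] (mod int p)" for t i
  proof -
    have "[(curve d I t i - 1) mod int p = curve d I t i - 1] (mod int p)"
      by simp
    from cong_add[OF this cong_refl[of 1]] show ?thesis
      by (simp add: X_def)
  qed
  have X_range: "1 \<le> X t i" "X t i \<le> int p" for t i
    using \<open>p > 2\<close> by (auto simp: X_def add1_zle_eq)
  define U where "U = {0..<int p}"
  have U_inj: "s = t" if "s \<in> U" "t \<in> U" "int p dvd s - t" for s t
    using that by (auto simp: U_def simp flip: mod_eq_dvd_iff)
  have inj: "inj_on pt U"
  proof (rule inj_onI)
    fix s t assume st: "s \<in> U" "t \<in> U" "pt s = pt t"
    have cong: "[curve d I s i = curve d I t i] (mod int p)" if "i < d" for i
    proof -
      have "X s i = X t i"
        using fun_cong[OF st(3), of i] that by (simp add: pt_def)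
      then show ?thesis
        by (metis X_cong cong_sym cong_trans)
    qed
    \<comment> \<open>The first and last coordinates are \<open>t + I * t ^ d\<close> and
      \<open>t ^ d + I * t\<close>; this combination cancels \<open>t ^ d\<close> and leaves
      \<open>2 * t\<close> modulo \<open>p\<close>.\<close>
    have "[curve d I s 0 - I * curve d I s (d - 1) = curve d I t 0 - I * curve d I t (d - 1)] (mod int p)"
      using d by (intro cong_diff cong_mult cong_refl cong) auto
    moreover have "curve d I u 0 - I * curve d I u (d - 1) = u - I\<^sup>2 * u" for u
      using d by (simp add: curve_def power2_eq_square algebra_simps)
    moreover have "[u - I\<^sup>2 * u = u - (-1) * u] (mod int p)" for u
      by (intro cong_diff cong_mult cong_refl I)
    ultimately have "[s - (-1) * s = t - (-1) * t] (mod int p)"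
      by (metis cong_sym cong_trans)
    then have "int p dvd 2 * (s - t)"
      by (simp add: cong_iff_dvd_diff algebra_simps)
    moreover have "\<not> int p dvd 2"
      using \<open>p > 2\<close> by (auto dest: zdvd_imp_le)
    ultimately have "int p dvd s - t"
      using p_int(1) prime_dvd_mult_iff by blast
    then show "s = t"
      using U_inj st by blast
  qed
  have grid: "pt ` U \<subseteq> grid n d"
  proof -
    have "real_of_int (X t i) \<in> real ` {1..n}" for t i
      using X_range[of t i] p(4) by (intro image_eqI[of _ _ "nat (X t i)"]) auto
    then show ?thesis
      by (auto simp: grid_def pt_def split: if_splits)
  qed
  have "no_cospherical d (pt ` U)"
    unfolding no_cospherical_def
  proof safe
    fix S V assume S: "is_sphere d S" and V: "V \<subseteq> pt ` U" "V \<subseteq> S" "card V = d + 2"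
    obtain T where T: "T \<subseteq> U" "V = pt ` T"
      using V(1) by (auto simp: subset_image_iff)
    have "inj_on pt T"
      using inj T(1) by (rule inj_on_subset)
    then have card_T: "card T = d + 2"
      using T V(3) by (simp add: card_image)
    have fin_T: "finite T"
      using T(1) by (rule finite_subset) (simp add: U_def)
    obtain u where u: "bij_betw u {0..<d+2} T"
      using ex_bij_betw_nat_finite[OF fin_T] card_T by auto
    obtain c where c: "\<exists>k<d+2. c k \<noteq> 0"
      "\<And>x. x \<in> S \<Longrightarrow> c 0 + (\<Sum>i<d. c (Suc i) * x i) + c (Suc d) * (\<Sum>i<d. (x i)\<^sup>2) = 0"
      using is_sphere_equation[OF S] by blast
    \<comment> \<open>Row \<open>r\<close> lists 1, the coordinates and the squared norm of the
      point with parameter \<open>u r\<close>.\<close>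
    define M where "M = (\<lambda>r k. if k = 0 then 1 else if k = Suc d then (\<Sum>i<d. (X (u r) i)\<^sup>2) else X (u r) (k - 1))"
    \<comment> \<open>The general ring covers both the real vector \<open>c\<close> and the integer
      vector \<open>w\<close>.\<close>
    have sum_M: "(\<Sum>k<d+2. of_int (M r k) * b k) = 
        b 0 + (\<Sum>i<d. b (Suc i) * of_int (X (u r) i)) + b (Suc d) * (\<Sum>i<d. (of_int (X (u r) i))\<^sup>2)"
      for r and b :: "nat \<Rightarrow> 'a :: comm_ring_1"
    proof -
      have "(\<Sum>k<d+2. of_int (M r k) * b k) = 
          of_int (M r 0) * b 0 + (\<Sum>i<d. of_int (M r (Suc i)) * b (Suc i)) + of_int (M r (Suc d)) * b (Suc d)"
        using sum.lessThan_Suc_shift[of "\<lambda>k. of_int (M r k) * b k" d] by simp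
      then show ?thesis
        by (simp add: M_def mult.commute)
    qed
    have kernel: "\<forall>r<d+2. (\<Sum>k<d+2. of_int (M r k) * c k) = 0"
    proof (intro allI impI)
      fix r assume "r < d + 2"
      then have "pt (u r) \<in> S"
        using u V(2) T(2) by (auto simp: bij_betw_def)
      from c(2)[OF this] show "(\<Sum>k<d+2. of_int (M r k) * c k) = 0"
        unfolding sum_M by (simp add: pt_def)
    qed
    have "\<not> is_unit (int p)"
      using \<open>p > 2\<close> by auto
    from int_kernel_not_dvd_if_real_kernel[OF this c(1) kernel]
    obtain w where w: "\<exists>k<d+2. \<not> int p dvd w k" "\<forall>r<d+2. (\<Sum>k<d+2. M r k * w k) = 0"
      by blast
    have "int p dvd w k" if "k < d + 2" for k
    proof (rule curve_relation_trivial[OF p_int I d fin_T card_T U_inj _ that])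
      fix t assume "t \<in> T"
      then obtain r where r: "r < d + 2" "t = u r"
        using u by (auto simp: bij_betw_def)
      have "[w 0 + (\<Sum>i<d. w (Suc i) * curve d I t i) + w (Suc d) * (\<Sum>i<d. (curve d I t i)\<^sup>2) =
          w 0 + (\<Sum>i<d. w (Suc i) * X t i) + w (Suc d) * (\<Sum>i<d. (X t i)\<^sup>2)] (mod int p)"
        by (intro cong_add cong_mult cong_sum cong_pow cong_refl cong_sym[OF X_cong])
      also have "w 0 + (\<Sum>i<d. w (Suc i) * X t i) + w (Suc d) * (\<Sum>i<d. (X t i)\<^sup>2) = 0"
        using sum_M[of r w] w(2) r by simp
      finally show "[w 0 + (\<Sum>i<d. w (Suc i) * curve d I t i) + 
          w (Suc d) * (\<Sum>i<d. (curve d I t i)\<^sup>2) = 0] (mod int p)" .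
    qed (use T(1) in auto)
    then show False
      using w(1) by blast
  qed
  then have "card (pt ` U) \<le> f_sph n d"
    unfolding f_sph_def using grid by (intro Max_ge f_sph_set_finite) blast
  then show ?thesis
    using inj by (simp add: card_image U_def)
qed

theorem corollary1p6:
  "\<exists>c::real. \<forall>d::nat. d \<ge> 3 \<longrightarrow>
     (\<lambda>n::nat. real (f_sph n d)) \<in>
       \<Omega>(\<lambda>n. real n powr (real (min d 4) / real (d + 1) - c / ln (ln (real n))))"
proof (intro exI[of _ 0] allI impI landau_omega.bigI[of 1])
  fix d :: nat
  assume d: "d \<ge> 3"
  \<comment> \<open>Equality holds at \<open>d = 4\<close>; the value is \<open>3/4\<close> at
    \<open>d = 3\<close> and \<open>4 / (d + 1)\<close> beyond 4.\<close>
  have exponent: "real (min d 4) / real (d + 1) \<le> 4 / 5"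
    using d by (simp add: field_simps min_def)
  \<comment> \<open>This secures \<open>2 * d < p\<close> for the prime chosen below.\<close>
  have "filterlim (\<lambda>x::real. x powr (4/5)) at_top at_top"
    by real_asymp
  then have "eventually (\<lambda>x::real. 2 * real d < x powr (4/5)) at_top"
    by (simp add: filterlim_at_top_dense)
  then have "eventually (\<lambda>n::nat. 2 * real d < real n powr (4/5)) at_top"
    by (rule eventually_compose_filterlim[OF _ filterlim_real_sequentially])
  then show "eventually (\<lambda>n. norm (real (f_sph n d)) \<ge>
      1 * norm (real n powr (real (min d 4) / real (d + 1) - 0 / ln (ln (real n))))) at_top"
    using eventually_prime_1_mod_4 eventually_ge_at_top[of 1]
  proof eventually_elim
    case (elim n)
    then obtain p where p: "prime p" "p mod 4 = 1" "p \<le> n" "real n powr (4/5) \<le> real p"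
      by blast
    have "real n powr (real (min d 4) / real (d + 1)) \<le> real n powr (4/5)"
      using exponent elim(3) by (intro powr_mono) auto
    also have "\<dots> \<le> real p"
      by (rule p)
    also have "\<dots> \<le> real (f_sph n d)"
      using p elim(1) d by (intro of_nat_mono f_sph_ge_prime) auto
    finally show ?case
      by simp
  qed
qed simp

end
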